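(* Let $k,j$ be positive integers with $j \geq 4$. Then $RR(\mathcal{E}(k,j)) \leq \binom{j+1}{2}$. Furthermore, for all positive integers $k \geq \frac{(j^2-2)(j+1)}{2}$, we have $RR(\mathcal{E}(k,j)) = \binom{j+1}{2}$.
   Context: For a positive integer $k$ and an integer $j > -k$, $\mathcal{E}(k,j)$ denotes the equation $x+y+kz=(k+j)w$. A $2$-coloring of $[1,N]=\{1,2,\dots,N\}$ is a map $\chi:[1,N]\to\{0,1\}$; a solution $(x,y,z,w)$ with $x,y,z,w\in[1,N]$ (not necessarily distinct) is monochromatic if $\chi(x)=\chi(y)=\chi(z)=\chi(w)$. For an equation $\mathcal{E}$, $RR(\mathcal{E})$ denotes the minimum positive integer $N$ such that every $2$-coloring of $[1,N]$ admits a monochromatic solution to $\mathcal{E}$ in $[1,N]$. *)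

theory Defs
  imports Complex_Main "HOL-Library.Extended_Nat" "HOL-Library.FuncSet"
begin

type_synonym equation4 = "nat \<Rightarrow> nat \<Rightarrow> nat \<Rightarrow> nat \<Rightarrow> bool"

definition rado_eq :: "nat \<Rightarrow> int \<Rightarrow> equation4" where
  "rado_eq k j x y z w \<longleftrightarrow> int x + int y + int k * int z = (int k + j) * int w"

definition has_mono_solution :: "equation4 \<Rightarrow> nat \<Rightarrow> (nat \<Rightarrow> nat) \<Rightarrow> bool" where
  "has_mono_solution Eq N \<chi> \<longleftrightarrow>
     (\<exists>x\<in>{1..N}. \<exists>y\<in>{1..N}. \<exists>z\<in>{1..N}. \<exists>w\<in>{1..N}.
        Eq x y z w \<and> \<chi> x = \<chi> y \<and> \<chi> y = \<chi> z \<and> \<chi> z = \<chi> w)"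

text \<open>The value is an extended natural: it is \<open>\<infinity>\<close> exactly when no such \<open>N\<close> exists, so an upper
  bound by a natural number includes the existence of the minimum.\<close>

definition RR :: "equation4 \<Rightarrow> enat" where
  "RR Eq = Inf {enat N | N. N \<ge> 1 \<and> (\<forall>\<chi> \<in> {1..N} \<rightarrow> {0, 1}. has_mono_solution Eq N \<chi>)}"

end

theory Submission
  imports Defs
begin

text \<open>Solutions with \<open>z = w\<close> are exactly the solutions of \<open>x + y = j w\<close>, and for large \<open>k\<close> there
  are no others in the range considered, so everything reduces to the two-colour Rado number of
  \<open>x + y = j w\<close>. For its upper bound, the colour of \<open>1\<close> is propagated: whenever \<open>a\<close> and \<open>a + j\<close>
  have different colours, the colour of \<open>a\<close> is inherited from \<open>i\<close> by \<open>i + 1\<close>, via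
  \<open>a + y = j i\<close> and \<open>(a + j) + y = j (i + 1)\<close>. For the lower bound, numbers below \<open>j / 2\<close>
  get one colour and the numbers from \<open>j / 2\<close> to \<open>j\<close> the other, and this is extended by residues
  modulo \<open>j\<close>.\<close>

section \<open>Upper bound for \<open>x + y = j * w\<close>: forced colours\<close>

definition avoids :: "nat \<Rightarrow> nat \<Rightarrow> (nat \<Rightarrow> bool) \<Rightarrow> bool" where
  "avoids j N P \<longleftrightarrow>
     (\<forall>x\<in>{1..N}. \<forall>y\<in>{1..N}. \<forall>w\<in>{1..N}. x + y = j * w \<longrightarrow> \<not> (P x = P y \<and> P y = P w))"

lemma avoidsD:
  assumes "avoids j N P" "x + y = j * w" "1 \<le> x" "x \<le> N" "1 \<le> y" "y \<le> N" "1 \<le> w" "w \<le> N"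
  shows "\<not> (P x = P y \<and> P y = P w)"
  using assms unfolding avoids_def by auto

lemma propagate:
  assumes "avoids j N P" "P a" "\<not> P b" "P i" and b: "b = a + j"
    and "a < j * i" "j * i \<le> N + a" "1 \<le> a" "b \<le> N" "1 \<le> i" "i + 1 \<le> N"
  shows "P (i + 1)"
proof -
  \<comment> \<open>\<open>y\<close> pairs with \<open>a\<close> at \<open>i\<close> and with
    \<open>b\<close> at \<open>i + 1\<close>: the first solution forces \<open>y\<close> into the
    colour of \<open>b\<close>, the second then forces \<open>i + 1\<close> out of it.\<close>
  define y where "y = j * i - a"
  have y: "a + y = j * i" "b + y = j * (i + 1)" "1 \<le> y" "y \<le> N"
    using assms(6,7) b by (auto simp: y_def)
  have "\<not> P y"
    using avoidsD[OF assms(1) y(1)] assms y by auto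
  then show ?thesis
    using avoidsD[OF assms(1) y(2)] assms y by auto
qed

lemma even_upper:
  assumes av: "avoids (2 * m) (m * (2 * m + 1)) P" and m: "2 \<le> m" and P1: "P 1"
  shows False
proof -
  define N where "N = m * (2 * m + 1)"
  have sq: "2 * m \<le> m * m" using m by simp
  have N: "N = 2 * (m * m) + m" by (simp add: N_def algebra_simps)
  have av: "avoids (2 * m) N P" using av by (simp add: N_def)
  note D = avoidsD[OF av]
  have Pm: "\<not> P m"
    using D[of m m 1] P1 m N sq by auto
  \<comment> \<open>Otherwise the pair \<open>1\<close>, \<open>2 * m + 1\<close> would carry the
    colour of \<open>1\<close> up to \<open>m\<close>.\<close>
  have Pj1: "P (2 * m + 1)"
  proof (rule ccontr)
    assume neg: "\<not> P (2 * m + 1)"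
    have "P i" if "1 \<le> i" "i \<le> m" for i
      using that
    proof (induction i rule: nat_induct_at_least)
      case base
      show ?case by (rule P1)
    next
      case (Suc i)
      have i: "1 \<le> i" "i + 1 \<le> m" and Pi: "P i" using Suc by simp_all
      have "m * 1 \<le> m * i" "m * i \<le> m * m" using i by (intro mult_le_mono; simp)+
      then have "P (i + 1)"
        by (intro propagate[OF av P1 neg Pi]) (use i N sq m in linarith)+
      then show ?case by simp
    qed
    then show False using Pm m by simp
  qed
  have PN: "\<not> P N"
    using D[of N N "2 * m + 1"] Pj1 N sq m by (auto simp: algebra_simps)
  have Pm1: "P (m + 1)"
    using D[of m N "m + 1"] PN Pm N sq m by (auto simp: algebra_simps)
  \<comment> \<open>\<open>a = N - 2 * m\<close> is the partner of \<open>m\<close> at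
    \<open>w = m\<close>, hence coloured opposite to \<open>N\<close>. This second pair at distance
    \<open>j\<close> carries the colour of \<open>m + 1\<close> up to \<open>2 * m - 1\<close>, the
    partner of \<open>1\<close> at \<open>w = 1\<close>.\<close>
  define a where "a = 2 * (m * m) - m"
  have a: "a + m = 2 * m * m" "a + 2 * m = N" "1 \<le> a" "a \<le> N"
    using sq m N unfolding a_def by linarith+
  have Pa: "P a"
    using D[of a m m] a Pm N sq m by auto
  have "P i" if "m + 1 \<le> i" "i \<le> 2 * m" for i
    using that
  proof (induction i rule: nat_induct_at_least)
    case base
    show ?case by (rule Pm1)
  next
    case (Suc i)
    have i: "m + 1 \<le> i" "i + 1 \<le> 2 * m" and Pi: "P i" using Suc by simp_all
    have "m * m \<le> m * i" "m * i \<le> m * (2 * m)" using i by (intro mult_le_mono; simp)+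
    then have "P (i + 1)"
      by (intro propagate[OF av Pa PN Pi]) (use i a N sq m in linarith)+
    then show ?case by simp
  qed
  then have "P (2 * m - 1)" using m by simp
  then show False
    using D[of 1 "2 * m - 1" 1] P1 N sq m by auto
qed

text \<open>An odd \<open>j\<close> has no midpoint to start from. The second propagation, by
  \<open>j * m\<close> and \<open>N\<close>, is instead used in reverse: since \<open>2 * m\<close>
  has the other colour, so has all of \<open>m + 1\<close> to \<open>2 * m\<close>.\<close>

lemma odd_upper:
  assumes j: "j = 2 * m + 1" and av: "avoids j (j * (m + 1)) P" and m: "2 \<le> m" and P1: "P 1"
  shows False
proof -
  define N where "N = j * (m + 1)"
  have sq: "2 * m \<le> m * m" using m by simp
  have N: "N = 2 * (m * m) + 3 * m + 1" by (simp add: N_def j algebra_simps)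
  have av: "avoids j N P" using av by (simp add: N_def)
  note D = avoidsD[OF av]
  have P2m: "\<not> P (2 * m)"
    using D[of 1 "2 * m" 1] P1 N j m by auto
  have Pjm: "P (j * m)"
    using D[of "j * m" "j * m" "2 * m"] P2m N j m by (auto simp: algebra_simps)
  \<comment> \<open>Otherwise the colour of \<open>1\<close> would reach both \<open>m\<close> and
    \<open>m + 1\<close>, whose sum is \<open>j\<close>.\<close>
  have Pj1: "P (j + 1)"
  proof (rule ccontr)
    assume neg: "\<not> P (j + 1)"
    have *: "P i" if "1 \<le> i" "i \<le> m + 1" for i
      using that
    proof (induction i rule: nat_induct_at_least)
      case base
      show ?case by (rule P1)
    next
      case (Suc i)
      have i: "1 \<le> i" "i \<le> m" and Pi: "P i" using Suc by simp_all
      have ji: "j * i = 2 * (m * i) + i" by (simp add: j algebra_simps)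
      have "m * 1 \<le> m * i" "m * i \<le> m * m" using i by (intro mult_le_mono; simp)+
      then have "P (i + 1)"
        by (intro propagate[OF av P1 neg Pi]) (use i ji j N sq m in linarith)+
      then show ?case by simp
    qed
    have "P m" "P (m + 1)" using * m by simp_all
    then show False
      using D[of m "m + 1" 1] P1 N j m by auto
  qed
  have PN: "\<not> P N"
    using D[of N N "j + 1"] Pj1 N j m by (auto simp: algebra_simps)
  have high: "\<not> P i" if i: "m + 1 \<le> i" "i \<le> 2 * m" for i
  proof
    assume "P i"
    have "P n" if "i \<le> n" "n \<le> 2 * m" for n
      using that
    proof (induction n rule: nat_induct_at_least)
      case base
      show ?case by fact
    next
      case (Suc n)
      have n: "m + 1 \<le> n" "n + 1 \<le> 2 * m" and Pn: "P n" using Suc i by simp_all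
      have jn: "j * n = 2 * (m * n) + n" "j * m = 2 * (m * m) + m" by (simp_all add: j algebra_simps)
      have "m * m \<le> m * n" "m * n \<le> m * (2 * m)" using n by (intro mult_le_mono; simp)+
      then have "P (n + 1)"
        by (intro propagate[OF av Pjm PN Pn]) (use n jn j N sq m in linarith)+
      then show ?case by simp
    qed
    then show False using P2m i by simp
  qed
  \<comment> \<open>\<open>N + j = j * (m + 2)\<close>. Here \<open>2 <= m\<close> puts
    \<open>m + 2\<close>, and later \<open>2 * m - 1\<close>, in the range of
    \<open>high\<close>.\<close>
  have Pj: "P j"
    using D[of N j "m + 2"] high[of "m + 2"] PN N j m by (auto simp: algebra_simps)
  have P2: "\<not> P 2"
    using D[of j j 2] Pj N j m by auto
  \<comment> \<open>The final solution has sum \<open>j * j\<close>; each summand is coloured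
    through its complement to \<open>N = j * (m + 1)\<close>, namely \<open>2 * m - 1\<close> or
    \<open>2\<close>.\<close>
  have "P (j * m + 2)"
    using D[of "j * m + 2" "2 * m - 1" "m + 1"] high[of "2 * m - 1"] high[of "m + 1"] N j m
    by (auto simp: algebra_simps)
  moreover have "P (j * m + (2 * m - 1))"
    using D[of "j * m + (2 * m - 1)" 2 "m + 1"] P2 high[of "m + 1"] N j m
    by (auto simp: algebra_simps)
  ultimately show False
    using D[of "j * m + 2" "j * m + (2 * m - 1)" j] Pj N j m by (auto simp: algebra_simps)
qed

lemma not_avoids_choose:
  assumes "4 \<le> j"
  shows "\<not> avoids j ((j + 1) choose 2) P"
proof
  assume av: "avoids j ((j + 1) choose 2) P"
  \<comment> \<open>Renaming the colours gives \<open>1\<close> the colour true.\<close>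
  define Q where "Q n \<longleftrightarrow> (P n = P 1)" for n
  have avQ: "avoids j ((j + 1) choose 2) Q"
    using av unfolding avoids_def Q_def by metis
  have Q1: "Q 1" by (simp add: Q_def)
  show False
  proof (cases "even j")
    case True
    then obtain m where m: "j = 2 * m" by blast
    then have "(j + 1) choose 2 = m * (2 * m + 1)"
      by (simp add: choose_two)
    with even_upper[of m Q] avQ Q1 m assms show False by simp
  next
    case False
    then obtain m where m: "j = 2 * m + 1" by (blast elim: oddE)
    then have "(j + 1) choose 2 = j * (m + 1)"
      by (simp add: choose_two)
    with odd_upper[of j m Q] avQ Q1 m assms show False by simp
  qed
qed

section \<open>Lower bound for \<open>x + y = j * w\<close>: explicit colourings\<close>

lemma avoids_four: "avoids 4 9 (\<lambda>n. n \<in> {2, 3, 7, 8})"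
  unfolding avoids_def
proof (intro ballI impI)
  fix x y w :: nat
  assume x: "x \<in> {1..9}" and y: "y \<in> {1..9}" and eq: "x + y = 4 * w"
  from x have "x \<in> {1, 2, 3, 4, 5, 6, 7, 8, 9}" by auto
  moreover have "w \<in> {1, 2, 3, 4}" "y = 4 * w - x" using x y eq by auto
  ultimately show "\<not> ((x \<in> {2, 3, 7, 8}) = (y \<in> {2, 3, 7, 8}) \<and>
      (y \<in> {2, 3, 7, 8}) = (w \<in> {2, 3, 7, 8}))"
    using y by (elim insertE emptyE; simp)
qed

lemma two_choose: "2 * ((j + 1) choose 2) = j * (j + 1)"
  by (simp add: choose_two)

text \<open>Here \<open>h\<close> is \<open>j / 2\<close> rounded up. The pairs of self-complementary residues \<open>0\<close> and \<open>j / 2\<close> are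
  separated by a threshold, the other residues by their size.\<close>

definition residue_colouring :: "nat \<Rightarrow> nat \<Rightarrow> bool" where
  "residue_colouring j n \<longleftrightarrow> (let r = n mod j; h = (j + 1) div 2 in
     (if r = 0 \<or> 2 * r = j then 2 * n < j * h else j < 2 * r \<and> n < j * (h - 1)))"

text \<open>The residues of \<open>x\<close> and \<open>y\<close> are complementary modulo
  \<open>j\<close>. It remains that \<open>x\<close> and \<open>y\<close> are not both true when
  \<open>w\<close> is true, and not both false when \<open>w\<close> is false.\<close>

lemma avoids_residue_colouring:
  assumes j: "5 \<le> j"
  shows "avoids j (((j + 1) choose 2) - 1) (residue_colouring j)"
  unfolding avoids_def
proof (intro ballI impI)
  let ?c = "residue_colouring j"
  define h where "h = (j + 1) div 2"
  define M where "M = ((j + 1) choose 2) - 1"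
  have h: "3 \<le> h" "j \<le> 2 * h" "2 * h \<le> j + 1"
    using j by (auto simp: h_def)
  have M: "2 * M < j * (j + 1)"
    using two_choose[of j] j by (cases "(j + 1) choose 2") (auto simp: M_def)
  note c_def = residue_colouring_def[of j, folded h_def, unfolded Let_def]
  fix x y w
  assume x: "x \<in> {1..((j + 1) choose 2) - 1}" and y: "y \<in> {1..((j + 1) choose 2) - 1}"
    and w: "w \<in> {1..((j + 1) choose 2) - 1}" and eq: "x + y = j * w"
  have pos: "0 < x" "0 < y" "0 < w" using x y w by auto
  have "x \<le> M" "y \<le> M"
    using x y by (simp_all only: M_def atLeastAtMost_iff)
  then have "j * w < j * (j + 1)"
    using M eq by linarith
  then have wj: "w \<le> j" using nat_mult_less_cancel_disj[of j w "j + 1"] by linarith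
  \<comment> \<open>Up to \<open>j\<close> the colouring is a plain cut at \<open>h\<close>; at
    \<open>w = j\<close> this needs \<open>h >= 3\<close>.\<close>
  have cw: "?c w \<longleftrightarrow> h \<le> w"
  proof (cases "w = j")
    case True
    then show ?thesis using h j by (auto simp: c_def)
  next
    case False
    then have r: "w mod j = w" using wj by simp
    have "j * 2 \<le> j * (h - 1)" using h by (intro mult_le_mono) auto
    moreover have "j * 3 \<le> j * h" using h by (intro mult_le_mono) auto
    ultimately have "w < j * (h - 1)" "2 * w < j * h"
      using False wj by linarith+
    then show ?thesis using r pos h by (auto simp: c_def)
  qed
  define r s where "r = x mod j" and "s = y mod j"
  have rs: "r < j" "s < j" using j by (auto simp: r_def s_def)
  have "(r + s) mod j = 0"
    using eq unfolding r_def s_def by (metis mod_add_eq mod_mult_self1_is_0)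
  then obtain t where t: "r + s = j * t" by auto
  have "j * t < j * 2" using t rs by linarith
  then have "t < 2" using nat_mult_less_cancel_disj by blast
  then have sum: "r + s = 0 \<or> r + s = j"
    using t by (cases t) (auto simp: less_Suc_eq)
  have small: "j * w \<le> j * (h - 1)" "j * w < j * h" if "\<not> h \<le> w"
    using that j by (auto intro!: mult_le_mono)
  have big: "j * h \<le> j * w" if "h \<le> w"
    using that by simp
  show "\<not> (?c x = ?c y \<and> ?c y = ?c w)"
  proof (cases "r = 0 \<or> 2 * r = j")
    case True
    \<comment> \<open>Both numbers meet the same threshold, half of \<open>j * h\<close>, and
      \<open>w\<close> decides whether their sum reaches \<open>j * h\<close>.\<close>
    then have "s = 0 \<or> 2 * s = j" using sum rs by auto
    then have "?c x \<longleftrightarrow> 2 * x < j * h" "?c y \<longleftrightarrow> 2 * y < j * h"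
      using True by (auto simp: c_def simp flip: r_def s_def)
    moreover have "\<not> (2 * x < j * h \<and> 2 * y < j * h)" if "h \<le> w"
      using big[OF that] eq by linarith
    moreover have "2 * x < j * h \<or> 2 * y < j * h" if "\<not> h \<le> w"
      using small(2)[OF that] eq by linarith
    ultimately show ?thesis using cw by metis
  next
    case False
    \<comment> \<open>Exactly one residue exceeds \<open>j / 2\<close>, so \<open>x\<close> and
      \<open>y\<close> are never both true; for \<open>w < h\<close> the size cutoff holds for both,
      so exactly one is true.\<close>
    then have "\<not> (s = 0 \<or> 2 * s = j)" using sum rs by auto
    then have "?c x \<longleftrightarrow> j < 2 * r \<and> x < j * (h - 1)" "?c y \<longleftrightarrow> j < 2 * s \<and> y < j * (h - 1)"
      using False by (auto simp: c_def simp flip: r_def s_def)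
    moreover have "x < j * (h - 1)" "y < j * (h - 1)" if "\<not> h \<le> w"
      using small(1)[OF that] eq pos by linarith+
    moreover have "j < 2 * r \<longleftrightarrow> \<not> j < 2 * s"
      using sum False by auto
    ultimately show ?thesis using cw by metis
  qed
qed

lemma ex_avoids:
  assumes "4 \<le> j"
  shows "\<exists>P. avoids j (((j + 1) choose 2) - 1) P"
proof (cases "j = 4")
  \<comment> \<open>Here \<open>h\<close> would be \<open>2\<close>, and
    \<open>8 + 8 = 4 * 4\<close> would be monochromatic under
    \<open>residue_colouring\<close>.\<close>
  case True
  then show ?thesis using avoids_four by (auto simp: choose_two)
next
  case False
  then show ?thesis using assms avoids_residue_colouring[of j] by auto
qed

section \<open>Transfer to the equation in four variables\<close>

lemma has_mono_solution_choose:
  assumes "4 \<le> j" "\<chi> \<in> {1..(j + 1) choose 2} \<rightarrow> {0, 1}"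
  shows "has_mono_solution (rado_eq k (int j)) ((j + 1) choose 2) \<chi>"
proof (rule ccontr)
  let ?N = "(j + 1) choose 2"
  assume no: "\<not> has_mono_solution (rado_eq k (int j)) ?N \<chi>"
  have two: "\<chi> n = 0 \<or> \<chi> n = 1" if "n \<in> {1..?N}" for n
    using assms(2) that by blast
  have "avoids j ?N (\<lambda>n. \<chi> n = 0)"
    unfolding avoids_def
  proof (intro ballI impI notI)
    fix x y w
    assume *: "x \<in> {1..?N}" "y \<in> {1..?N}" "w \<in> {1..?N}" and eq: "x + y = j * w"
      and same: "(\<chi> x = 0) = (\<chi> y = 0) \<and> (\<chi> y = 0) = (\<chi> w = 0)"
    have "\<chi> x = \<chi> y" "\<chi> y = \<chi> w"
      using two[OF *(1)] two[OF *(2)] two[OF *(3)] same by auto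
    moreover have "rado_eq k (int j) x y w w"
      using arg_cong[OF eq, of int] by (simp add: rado_eq_def algebra_simps)
    ultimately show False
      using no * unfolding has_mono_solution_def by metis
  qed
  then show False using not_avoids_choose[OF assms(1)] by simp
qed

text \<open>In the form \<open>x + y - j * w = k * (w - z)\<close>, the left side is smaller than
  \<open>k\<close> in absolute value, so both sides vanish.\<close>

lemma rado_eq_large_k:
  assumes "rado_eq k (int j) x y z w" and "2 * M + 2 \<le> j * (j + 1)" "4 \<le> j"
    and k: "(int j ^ 2 - 2) * (int j + 1) \<le> 2 * int k"
    and "x \<in> {1..M}" "y \<in> {1..M}" "z \<in> {1..M}" "w \<in> {1..M}"
  shows "z = w \<and> x + y = j * w"
proof -
  have eq: "int x + int y - int j * int w = int k * (int w - int z)"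
    using assms(1) by (simp add: rado_eq_def algebra_simps)
  have M: "2 * int M + 2 \<le> int j * int j + int j"
    using assms(2)[folded of_nat_le_iff[where 'a = int]] by (simp add: algebra_simps)
  have jj: "4 * int j \<le> int j * int j" "int j * int j * 4 \<le> int j * int j * int j"
    using assms(3) by (auto intro!: mult_right_mono mult_left_mono)
  have k': "int j * int j * int j + int j * int j - 2 * int j - 2 \<le> 2 * int k"
    using k by (simp add: algebra_simps power2_eq_square)
  have bounds: "1 \<le> int x" "int x \<le> int M" "1 \<le> int y" "int y \<le> int M" "int w \<le> int M"
    using assms by auto
  have "\<not> int z < int w"
  proof
    assume "int z < int w"
    then have "int k * 1 \<le> int k * (int w - int z)"
      by (intro mult_left_mono) auto
    moreover have "0 \<le> int j * int w" by simp
    ultimately show False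
      using eq M k' jj bounds assms(3) by linarith
  qed
  \<comment> \<open>This case matches the bound on \<open>k\<close>: \<open>j * w - x - y\<close> is
    at most \<open>j * M - 2\<close>, while for the largest admissible \<open>M\<close> the
    hypothesis says \<open>k >= j * M - 1\<close>.\<close>
  moreover have "\<not> int w < int z"
  proof
    assume "int w < int z"
    then have "int k * 1 \<le> int k * (int z - int w)"
      by (intro mult_left_mono) auto
    then have "int k \<le> int j * int w - int x - int y"
      using eq by (simp add: algebra_simps)
    moreover have "int j * int w \<le> int j * int M"
      using bounds by (intro mult_left_mono) auto
    moreover have "int j * (2 * int M + 2) \<le> int j * (int j * int j + int j)"
      using M by (intro mult_left_mono) auto
    then have "2 * (int j * int M) + 2 * int j \<le> int j * int j * int j + int j * int j"
      by (simp add: algebra_simps)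
    ultimately show False
      using k' bounds by linarith
  qed
  ultimately have "z = w" by simp
  then have "int (x + y) = int (j * w)" using eq by simp
  then show ?thesis using \<open>z = w\<close> by (simp only: of_nat_eq_iff)
qed

theorem theorem2:
  fixes j :: nat
  assumes "j \<ge> 4"
  shows "(\<forall>k::nat. k \<ge> 1 \<longrightarrow> RR (rado_eq k (int j)) \<le> enat ((j + 1) choose 2)) \<and>
         (\<forall>k::nat. k \<ge> 1 \<and> real k \<ge> ((real j)\<^sup>2 - 2) * (real j + 1) / 2 \<longrightarrow>
            RR (rado_eq k (int j)) = enat ((j + 1) choose 2))"
proof -
  let ?N = "(j + 1) choose 2"
  have twoN: "2 * ?N = j * (j + 1)"
    by (rule two_choose)
  have "2 * 1 \<le> 2 * ?N" using assms unfolding twoN by simp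
  then have N1: "1 \<le> ?N" by linarith
  have upper: "RR (rado_eq k (int j)) \<le> enat ?N" for k
    unfolding RR_def using has_mono_solution_choose[OF assms] N1 by (intro Inf_lower) blast
  have lower: "enat ?N \<le> RR (rado_eq k (int j))"
    if k: "real k \<ge> ((real j)\<^sup>2 - 2) * (real j + 1) / 2" for k
    unfolding RR_def
  proof (intro Inf_greatest)
    fix e
    assume "e \<in> {enat N |N. N \<ge> 1 \<and> (\<forall>\<chi> \<in> {1..N} \<rightarrow> {0, 1}. has_mono_solution (rado_eq k (int j)) N \<chi>)}"
    then obtain M where e: "e = enat M"
      and M: "\<And>\<chi>. \<chi> \<in> {1..M} \<rightarrow> {0, 1} \<Longrightarrow> has_mono_solution (rado_eq k (int j)) M \<chi>"
      by blast
    have "real_of_int ((int j ^ 2 - 2) * (int j + 1)) \<le> real_of_int (2 * int k)"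
      using k by simp
    then have k': "(int j ^ 2 - 2) * (int j + 1) \<le> 2 * int k"
      by (simp only: of_int_le_iff)
    have "?N \<le> M"
    proof (rule ccontr)
      assume "\<not> ?N \<le> M"
      then have less: "M \<le> ?N - 1" "2 * M + 2 \<le> j * (j + 1)"
        using twoN by linarith+
      \<comment> \<open>A colouring good up to \<open>?N - 1\<close> also serves the shorter
        interval up to \<open>M\<close>.\<close>
      obtain P where P: "avoids j (?N - 1) P"
        using ex_avoids[OF assms] by blast
      define \<chi> where "\<chi> n = (if P n then 1 else 0::nat)" for n
      have \<chi>_eq: "\<chi> a = \<chi> b \<longleftrightarrow> P a = P b" for a b
        by (simp add: \<chi>_def)
      have "has_mono_solution (rado_eq k (int j)) M \<chi>"
        by (rule M) (auto simp: \<chi>_def)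
      then obtain x y z w where *: "x \<in> {1..M}" "y \<in> {1..M}" "z \<in> {1..M}" "w \<in> {1..M}"
        "rado_eq k (int j) x y z w" "\<chi> x = \<chi> y" "\<chi> y = \<chi> z" "\<chi> z = \<chi> w"
        unfolding has_mono_solution_def by blast
      then have "z = w" "x + y = j * w"
        using rado_eq_large_k[OF *(5) less(2) assms k'] by simp_all
      moreover have "P x = P y" "P y = P w"
        using *(6-8) unfolding \<chi>_eq by simp_all
      ultimately show False
        using avoidsD[OF P \<open>x + y = j * w\<close>] *(1,2,4) less(1) by auto
    qed
    then show "enat ?N \<le> e" by (simp add: e)
  qed
  show ?thesis using upper lower by (simp add: order_antisym)
qed

end
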